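(* Let $k \ge 1$ and $l_1, \ldots, l_k \ge 1$ be integers, and let $A = \{1,\ldots,1,2,\ldots,2,\ldots,k,\ldots,k\}$ be the multiset in which the number $i$ appears $l_i$ times, with $|A| = n = \sum_{i=1}^k l_i \ge 2$. Let $W$ be the number of fixed points of a uniformly random permutation of the elements of $A$, and let $\mu = \sum_{i=1}^{k} l_i^3$. Then $\lambda := \mathbb{E}(W) = \frac{1}{n}\sum_{i=1}^{k} l_i^2$ and $$\|\mathcal{L}(W) - \mathrm{Poi}_\lambda\|_{TV} \leq (1.4)\left[ \frac{\lambda^{3/2}}{n-1} + \frac{3\mu}{2n^2\lambda^{1/2}} \right].$$
   Context: List the elements of $A$ (with repetition) as $a_1,\ldots,a_n$. A random permutation of the elements of $A$ means a uniformly random element $\sigma$ of $S_n$ (all $n!$ permutations equally likely) acting on the $n$ listed elements, and the number of fixed points is the number of symbol matches, $W = |\{j \in \{1,\ldots,n\} : a_{\sigma(j)} = a_j\}|$ (so a match is counted whenever a symbol $i$ is sent to any copy of the symbol $i$). $\mathcal{L}(W)$ denotes the law of $W$ and $\mathrm{Poi}_\lambda$ the Poisson distribution with mean $\lambda$. The total variation distance is $\|\mu_1-\mu_2\|_{TV} = \sup_B |\mu_1(B)-\mu_2(B)|$, the supremum being over all measurable sets $B$. *)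

theory Defs
  imports
    "HOL-Probability.Probability"
    "HOL-Combinatorics.Permutations"
    "HOL-Library.Multiset"
begin

definition block_multiset :: "nat \<Rightarrow> (nat \<Rightarrow> nat) \<Rightarrow> nat multiset" where
  "block_multiset k l = (\<Sum>i=1..k. replicate_mset (l i) i)"

(* Positions in lists are numbered from 0, so S_n acts on {..<n}. *)

definition random_permutation :: "nat \<Rightarrow> (nat \<Rightarrow> nat) pmf" where
  "random_permutation n = pmf_of_set {\<sigma>. \<sigma> permutes {..<n}}"

definition num_matches :: "'a list \<Rightarrow> (nat \<Rightarrow> nat) \<Rightarrow> nat" where
  "num_matches a \<sigma> = card {j \<in> {..<length a}. a ! \<sigma> j = a ! j}"

(* Intended for probability measures M and N with sets M = sets N; the supremum
   is then over a nonempty bounded set of reals. *)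
definition tv_dist :: "'a measure \<Rightarrow> 'a measure \<Rightarrow> real" where
  "tv_dist M N = (SUP B\<in>sets M. \<bar>measure M B - measure N B\<bar>)"

end

theory Submission
  imports Defs
begin

text \<open>Write \<open>W\<close> as the sum of the indicators of \<open>\<sigma> j = m\<close> over the pairs \<open>(j, m)\<close> with
  \<open>a\<^sub>j = a\<^sub>m\<close>. Composing \<open>\<sigma>\<close> with the transposition of \<open>\<sigma> j\<close> and \<open>m\<close> turns the uniform law into the
  uniform law conditioned on \<open>\<sigma> j = m\<close>; let \<open>W'\<close> be the resulting number of matches. The Stein
  solution for the Poisson law is Lipschitz with constant \<open>1 / \<lambda>\<close>, so the total variation distance
  is at most the average of \<open>|W + 1 - W'|\<close> over \<open>\<sigma>\<close> and the pairs. This difference vanishes unless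
  \<open>\<sigma> j\<close> or \<open>\<sigma>\<^sup>-\<^sup>1 m\<close> has the colour of \<open>j\<close>, or \<open>\<sigma> j\<close> and \<open>\<sigma>\<^sup>-\<^sup>1 m\<close> have the same colour, which gives the
  bound \<open>\<lambda> / (n - 1) + 2 \<mu> / (n\<^sup>2 \<lambda>)\<close>. As every \<open>l\<^sub>i\<close> is at least 1, so is
  \<open>\<lambda>\<close>, and the claimed bound is weaker.\<close>

section \<open>Stein equation for the Poisson law\<close>

context
  fixes lam :: real
  assumes lam_pos: "lam > 0"
begin

private abbreviation p :: "nat \<Rightarrow> real" where "p \<equiv> pmf (poisson_pmf lam)"
private abbreviation P :: "nat set \<Rightarrow> real" where "P \<equiv> measure_pmf.prob (poisson_pmf lam)"

lemma pmf_poisson_pos: "p j > 0"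
  using lam_pos by (simp add: pmf_poisson)

lemma pmf_poisson_Suc: "real (Suc j) * p (Suc j) = lam * p j"
  using lam_pos by (simp add: pmf_poisson field_simps del: of_nat_Suc)

lemma pmf_poisson_sums: "p sums 1"
proof -
  have "(\<lambda>n. lam ^ n /\<^sub>R fact n * exp (-lam)) sums (exp lam * exp (-lam))"
    by (intro sums_mult2 exp_converges)
  moreover have "p = (\<lambda>n. lam ^ n /\<^sub>R fact n * exp (-lam))"
    using lam_pos by (simp add: fun_eq_iff divide_inverse)
  ultimately show ?thesis by (simp add: exp_minus_inverse)
qed

lemma poisson_atMost_Suc: "P {..Suc j} = P {..j} + p (Suc j)"
  by (simp add: measure_measure_pmf_finite)

lemma poisson_tail: "1 - P {..j} = (\<Sum>i. p (i + Suc j))"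
  using suminf_minus_initial_segment[OF sums_summable[OF pmf_poisson_sums], of "Suc j"]
    sums_unique[OF pmf_poisson_sums]
  by (simp add: measure_measure_pmf_finite lessThan_Suc_atMost)

text \<open>Termwise on the tail: for \<open>i > j\<close>,
  \<open>(j + 1) p (i + 1) \<le> (i + 1) p (i + 1) = lam p i\<close>. Together with its counterpart
  below \<open>j\<close> it decides the signs in \<open>stein_sol_Suc_diff_le\<close>.\<close>

lemma poisson_tail_Suc_le: "real (Suc j) * (1 - P {..Suc j}) \<le> lam * (1 - P {..j})"
proof -
  have S: "summable (\<lambda>i. p (i + m))" for m
    using sums_summable[OF pmf_poisson_sums] by (rule summable_ignore_initial_segment)
  have "real (Suc j) * (\<Sum>i. p (i + Suc (Suc j))) = (\<Sum>i. real (Suc j) * p (i + Suc (Suc j)))"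
    by (rule suminf_mult[symmetric, OF S])
  also have "\<dots> \<le> (\<Sum>i. lam * p (i + Suc j))"
  proof (rule suminf_le)
    fix i
    have "real (Suc j) * p (i + Suc (Suc j)) \<le> real (Suc (i + Suc j)) * p (Suc (i + Suc j))"
      using pmf_poisson_pos[of "Suc (i + Suc j)"] by (simp add: mult_right_mono)
    then show "real (Suc j) * p (i + Suc (Suc j)) \<le> lam * p (i + Suc j)"
      by (simp only: pmf_poisson_Suc)
  qed (intro summable_mult S)+
  also have "\<dots> = lam * (\<Sum>i. p (i + Suc j))"
    by (rule suminf_mult[OF S])
  finally show ?thesis by (simp only: poisson_tail)
qed

text \<open>Mirror image of the tail estimate: for \<open>i \<le> j\<close>,
  \<open>lam p i = (i + 1) p (i + 1) \<le> (j + 1) p (i + 1)\<close>. The mass at 0 is dropped at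
  the end.\<close>

lemma poisson_cdf_Suc_ge: "lam * P {..j} \<le> real (Suc j) * P {..Suc j}"
proof -
  have "lam * P {..j} = (\<Sum>i\<le>j. real (Suc i) * p (Suc i))"
    by (simp add: measure_measure_pmf_finite sum_distrib_left pmf_poisson_Suc del: of_nat_Suc)
  also have "\<dots> \<le> (\<Sum>i\<le>j. real (Suc j) * p (Suc i))"
    by (intro sum_mono mult_right_mono) auto
  also have "\<dots> = real (Suc j) * (\<Sum>i\<le>j. p (Suc i))"
    by (rule sum_distrib_left[symmetric])
  also have "\<dots> \<le> real (Suc j) * P {..Suc j}"
    by (intro mult_left_mono)
      (simp_all add: measure_measure_pmf_finite sum.atMost_Suc_shift del: sum.atMost_Suc)
  finally show ?thesis .
qed

text \<open>The index is shifted by one against the usual Stein solution, which has an arbitrary value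
  at 0.\<close>

definition stein_sol :: "nat set \<Rightarrow> nat \<Rightarrow> real" where
  "stein_sol B j = (P (B \<inter> {..j}) - P B * P {..j}) / (lam * p j)"

lemma poisson_Int_atMost_Suc:
  "P (B \<inter> {..Suc j}) = P (B \<inter> {..j}) + indicator B (Suc j) * p (Suc j)"
proof (cases "Suc j \<in> B")
  case True
  then have "B \<inter> {..Suc j} = insert (Suc j) (B \<inter> {..j})" by auto
  then show ?thesis using True by (simp add: measure_measure_pmf_finite)
next
  case False
  then have "B \<inter> {..Suc j} = B \<inter> {..j}" by (auto simp: le_Suc_eq)
  then show ?thesis using False by simp
qed

text \<open>At 0 the truncated \<open>j - 1\<close> is harmless, since its term carries the factor
  \<open>real j\<close>. At a successor the Poisson recursion gives both terms the denominator
  \<open>p (Suc i)\<close>, and the numerators differ only by what happens at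
  \<open>Suc i\<close>.\<close>

lemma stein_equation:
  "lam * stein_sol B j - real j * stein_sol B (j - 1) = indicator B j - P B"
proof (cases j)
  case 0
  have "P (B \<inter> {0}) = indicator B 0 * p 0"
    by (cases "0 \<in> B") (auto simp: measure_measure_pmf_finite)
  then show ?thesis
    using 0 lam_pos pmf_poisson_pos[of 0]
    by (simp add: stein_sol_def measure_measure_pmf_finite field_simps)
next
  case (Suc i)
  have "real (Suc i) * stein_sol B i = (P (B \<inter> {..i}) - P B * P {..i}) / p (Suc i)"
    using pmf_poisson_Suc[of i, symmetric] pmf_poisson_pos[of "Suc i"]
    by (simp add: stein_sol_def del: of_nat_Suc)
  moreover have "lam * stein_sol B (Suc i) =
      (P (B \<inter> {..i}) - P B * P {..i}) / p (Suc i) + (indicator B (Suc i) - P B)"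
    using lam_pos pmf_poisson_pos[of "Suc i", THEN less_imp_neq]
    by (simp add: stein_sol_def poisson_Int_atMost_Suc poisson_atMost_Suc field_simps del: pmf_poisson)
  ultimately show ?thesis using Suc by simp
qed

text \<open>Split \<open>B\<close> into its parts up to \<open>j\<close>, at \<open>Suc j\<close>
  and beyond, of masses \<open>x\<close>, \<open>b\<close> and \<open>y\<close>. Only the atom at
  \<open>Suc j\<close> can contribute positively to the increment, and it contributes at most
  \<open>1 / lam\<close>.\<close>

lemma stein_sol_Suc_diff_le: "stein_sol B (Suc j) - stein_sol B j \<le> 1 / lam"
proof -
  define x where "x = P (B \<inter> {..j})"
  define b where "b = indicator B (Suc j) * p (Suc j)"
  define y where "y = P B - x - b"
  define U where "U = P {..j}"
  define q where "q = p (Suc j)"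
  have q: "q > 0" using pmf_poisson_pos by (simp add: q_def)
  have x: "x \<ge> 0" by (simp add: x_def)
  have b: "0 \<le> b" "b \<le> q" using q by (auto simp: b_def q_def indicator_def)
  have "P (B \<inter> {..Suc j}) \<le> P B" by (intro measure_pmf.finite_measure_mono) auto
  then have y: "y \<ge> 0" by (simp add: y_def x_def b_def poisson_Int_atMost_Suc)
  have PB: "P B = x + b + y" by (simp add: y_def)
  have R: "real (Suc j) * (1 - U - q) \<le> lam * (1 - U)"
    using poisson_tail_Suc_le[of j] by (simp add: U_def q_def poisson_atMost_Suc algebra_simps)
  have S: "lam * U \<le> real (Suc j) * (U + q)"
    using poisson_cdf_Suc_ge[of j] by (simp add: U_def q_def poisson_atMost_Suc)
  \<comment> \<open>Since \<open>lam * p j = lam * q / t\<close>, this factor brings both values of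
    the solution to the denominator \<open>lam * q\<close>.\<close>
  define t where "t = lam / real (Suc j)"
  have t: "t * U \<le> U + q" "1 - U - q \<le> t * (1 - U)"
    using R S by (simp_all add: t_def field_simps del: of_nat_Suc)
  have pj: "lam * p j = real (Suc j) * q" by (simp only: pmf_poisson_Suc q_def)
  have g0: "stein_sol B j = (x * (1 - U) - (y + b) * U) * t / (lam * q)"
    unfolding stein_sol_def pj x_def[symmetric] U_def[symmetric] PB t_def
    using lam_pos q by (simp add: field_simps del: of_nat_Suc)
  have g1: "stein_sol B (Suc j) = ((x + b) * (1 - U - q) - y * (U + q)) / (lam * q)"
    unfolding stein_sol_def poisson_Int_atMost_Suc poisson_atMost_Suc
      x_def[symmetric] U_def[symmetric] q_def[symmetric] PB
    by (simp add: b_def q_def algebra_simps)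
  \<comment> \<open>Collecting by \<open>x\<close>, \<open>y\<close> and \<open>b\<close>: the two
    bounds on \<open>t\<close> make the first two coefficients nonpositive, and
    \<open>t * U \<le> U + q\<close> bounds the third by 1.\<close>
  have "(x + b) * (1 - U - q) - y * (U + q) - (x * (1 - U) - (y + b) * U) * t
      = x * (1 - U - q - t * (1 - U)) + y * (t * U - (U + q)) + b * (1 - U - q + t * U)"
    by (simp add: algebra_simps)
  also have "\<dots> \<le> 0 + 0 + b * 1"
    using x y b t by (intro add_mono mult_left_mono mult_nonneg_nonpos) auto
  also have "\<dots> \<le> q" using b by simp
  finally have "stein_sol B (Suc j) - stein_sol B j \<le> q / (lam * q)"
    unfolding g0 g1 diff_divide_distrib[symmetric] using lam_pos q by (intro divide_right_mono) auto
  then show ?thesis using q by simp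
qed

text \<open>The numerator is additive in \<open>B\<close> and vanishes for the full set. This turns
  the upper bound on the increments into a two-sided one.\<close>

lemma stein_sol_Compl: "stein_sol (- B) j = - stein_sol B j"
proof -
  have 1: "P (- B) = 1 - P B"
    using measure_pmf.prob_compl[of B "poisson_pmf lam"] by (simp add: Compl_eq_Diff_UNIV)
  have 2: "P (- B \<inter> {..j}) = P {..j} - P (B \<inter> {..j})"
  proof -
    have "- B \<inter> {..j} = {..j} - B \<inter> {..j}" by auto
    then show ?thesis by (simp add: measure_pmf.finite_measure_Diff)
  qed
  show ?thesis
    by (simp add: stein_sol_def 1 2 minus_divide_left algebra_simps)
qed

lemma stein_sol_Suc_abs_le: "\<bar>stein_sol B (Suc j) - stein_sol B j\<bar> \<le> 1 / lam"
  using stein_sol_Suc_diff_le[of B j] stein_sol_Suc_diff_le[of "- B" j]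
  by (auto simp: stein_sol_Compl)

lemma stein_sol_lipschitz:
  "\<bar>stein_sol B i - stein_sol B j\<bar> \<le> \<bar>real i - real j\<bar> / lam"
proof -
  have *: "\<bar>stein_sol B (j + d) - stein_sol B j\<bar> \<le> real d / lam" for j d
  proof (induction d)
    case (Suc d)
    then show ?case
      using stein_sol_Suc_abs_le[of B "j + d"] by (simp add: add_divide_distrib)
  qed simp
  show ?thesis
    using *[of j "i - j"] *[of i "j - i"] by (cases "j \<le> i") auto
qed

end

section \<open>Counting permutations with prescribed values\<close>

lemma finite_permutes_filter: "finite S \<Longrightarrow> finite {\<sigma>. \<sigma> permutes S \<and> Q \<sigma>}"
  by (rule finite_subset[OF _ finite_permutations]) auto

text \<open>Left composition with a transposition is an involution, and it exchanges the two fibres.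
  The invariant predicate \<open>Q\<close> leaves room for a second prescribed value, as in
  \<open>card_permutes_at2\<close>.\<close>

lemma bij_betw_transpose_comp:
  assumes "m \<in> S" "m' \<in> S" "\<And>\<sigma>. Q (Transposition.transpose m' m \<circ> \<sigma>) \<longleftrightarrow> Q \<sigma>"
  shows "bij_betw ((\<circ>) (Transposition.transpose m' m)) {\<sigma>. \<sigma> permutes S \<and> \<sigma> j = m' \<and> Q \<sigma>}
    {\<sigma>. \<sigma> permutes S \<and> \<sigma> j = m \<and> Q \<sigma>}"
  by (rule bij_betw_byWitness[where f' = "(\<circ>) (Transposition.transpose m' m)"])
    (use assms in \<open>auto simp: o_assoc[symmetric] fun_eq_iff intro!: permutes_compose permutes_swap_id\<close>)

text \<open>Group the permutations by \<open>m' = \<sigma> j\<close>: each of the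
  \<open>card S\<close> fibres is mapped bijectively onto the fibre over \<open>m\<close>.\<close>

lemma sum_permutes_at:
  fixes h :: "('a \<Rightarrow> 'a) \<Rightarrow> real"
  assumes "finite S" "j \<in> S" "m \<in> S"
  shows "(\<Sum>\<sigma> | \<sigma> permutes S. h (Transposition.transpose (\<sigma> j) m \<circ> \<sigma>)) =
    real (card S) * (\<Sum>\<sigma> | \<sigma> permutes S \<and> \<sigma> j = m. h \<sigma>)"
proof -
  have "(\<Sum>\<sigma> | \<sigma> permutes S. h (Transposition.transpose (\<sigma> j) m \<circ> \<sigma>)) =
      (\<Sum>m'\<in>S. \<Sum>\<sigma> | \<sigma> \<in> {\<sigma>. \<sigma> permutes S} \<and> \<sigma> j = m'. h (Transposition.transpose (\<sigma> j) m \<circ> \<sigma>))"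
    using assms
    by (intro sum.group[symmetric]) (auto simp: finite_permutations permutes_in_image)
  also have "\<dots> = (\<Sum>m'\<in>S. \<Sum>\<sigma> | \<sigma> permutes S \<and> \<sigma> j = m'. h (Transposition.transpose m' m \<circ> \<sigma>))"
    by (intro sum.cong) auto
  also have "\<dots> = (\<Sum>m'\<in>S. \<Sum>\<sigma> | \<sigma> permutes S \<and> \<sigma> j = m. h \<sigma>)"
  proof (rule sum.cong[OF refl])
    fix m' assume "m' \<in> S"
    then have "bij_betw ((\<circ>) (Transposition.transpose m' m))
        {\<sigma>. \<sigma> permutes S \<and> \<sigma> j = m'} {\<sigma>. \<sigma> permutes S \<and> \<sigma> j = m}"
      using bij_betw_transpose_comp[OF assms(3), where Q = "\<lambda>_. True" and j = j] by simp
    then show "(\<Sum>\<sigma> | \<sigma> permutes S \<and> \<sigma> j = m'. h (Transposition.transpose m' m \<circ> \<sigma>)) =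
        (\<Sum>\<sigma> | \<sigma> permutes S \<and> \<sigma> j = m. h \<sigma>)"
      by (rule sum.reindex_bij_betw)
  qed
  finally show ?thesis by simp
qed

lemma card_permutes_at:
  assumes "finite S" "j \<in> S" "m \<in> S"
  shows "real (card S) * real (card {\<sigma>. \<sigma> permutes S \<and> \<sigma> j = m}) = fact (card S)"
  using sum_permutes_at[OF assms, of "\<lambda>_. 1"] assms(1) by (simp add: card_permutations)

text \<open>Among the permutations sending \<open>r\<close> to \<open>m\<close>, the
  \<open>card S - 1\<close> possible values of \<open>\<sigma> j\<close> are equally frequent:
  transposing two of them does not move \<open>m\<close>.\<close>

lemma card_permutes_at2:
  assumes "finite S" "j \<in> S" "r \<in> S" "m \<in> S" "m' \<in> S" "j \<noteq> r" "m \<noteq> m'"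
  shows "real (card S) * (real (card S) - 1) *
    real (card {\<sigma>. \<sigma> permutes S \<and> \<sigma> j = m' \<and> \<sigma> r = m}) = fact (card S)"
proof -
  let ?A = "\<lambda>x. {\<sigma>. \<sigma> permutes S \<and> \<sigma> j = x \<and> \<sigma> r = m}"
  have eq: "card (?A x) = card (?A m')" if "x \<in> S - {m}" for x
  proof -
    have "Transposition.transpose x m' v = m \<longleftrightarrow> v = m" for v
      using that assms(7) by (auto simp: Transposition.transpose_def)
    then show ?thesis
      using that assms(5)
      by (intro bij_betw_same_card[OF bij_betw_transpose_comp]) auto
  qed
  have "{\<sigma>. \<sigma> permutes S \<and> \<sigma> r = m} = (\<Union>x\<in>S - {m}. ?A x)"
    using assms by (auto simp: permutes_in_image inj_eq[OF permutes_inj])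
  then have "card {\<sigma>. \<sigma> permutes S \<and> \<sigma> r = m} = (\<Sum>x\<in>S - {m}. card (?A x))"
    using assms(1) by (simp, subst card_UN_disjoint) (auto intro: finite_permutes_filter)
  also have "\<dots> = (card S - 1) * card (?A m')"
    using eq assms(1,4) by simp
  finally have "card {\<sigma>. \<sigma> permutes S \<and> \<sigma> r = m} = (card S - 1) * card (?A m')" .
  moreover have "card S \<ge> 1"
    using assms(1,4) by (metis card_gt_0_iff empty_iff One_nat_def Suc_le_eq)
  ultimately show ?thesis
    using card_permutes_at[OF assms(1,3,4)] by (simp add: of_nat_diff algebra_simps)
qed

section \<open>Matches under a colouring and their size-bias coupling\<close>

context
  fixes S :: "'a set" and c :: "'a \<Rightarrow> 'b"
  assumes fin: "finite S"
begin

text \<open>These ordered pairs, diagonal included, index the indicators of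
  \<open>\<sigma> j = m\<close> that add up to the number of matches.\<close>

definition matching_pairs :: "('a \<times> 'a) set" where
  "matching_pairs = {(j, m) \<in> S \<times> S. c j = c m}"

definition matches :: "('a \<Rightarrow> 'a) \<Rightarrow> nat" where
  "matches \<sigma> = card {j \<in> S. c (\<sigma> j) = c j}"

definition colour_class :: "'b \<Rightarrow> 'a set" where
  "colour_class x = {j \<in> S. c j = x}"

lemma finite_matching_pairs: "finite matching_pairs"
  by (rule finite_subset[of _ "S \<times> S"]) (auto simp: matching_pairs_def fin)

text \<open>Each \<open>j\<close> is the first entry of as many pairs as its colour class has
  elements. The constant \<open>h = 1\<close> counts the pairs; taking the class size for
  \<open>h\<close> produces the sum of cubes over colours.\<close>

lemma sum_matching_pairs:
  fixes h :: "'b \<Rightarrow> real"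
  shows "(\<Sum>(j, m)\<in>matching_pairs. h (c j)) = (\<Sum>j\<in>S. real (card (colour_class (c j))) * h (c j))"
proof -
  have "matching_pairs = (SIGMA j:S. colour_class (c j))"
    by (auto simp: matching_pairs_def colour_class_def)
  moreover have "finite (colour_class (c j))" for j
    by (simp add: colour_class_def fin)
  ultimately show ?thesis
    using fin by (simp add: sum.Sigma[symmetric])
qed

lemma matches_sum:
  assumes "\<sigma> permutes S"
  shows "matches \<sigma> = (\<Sum>(j, m)\<in>matching_pairs. of_bool (\<sigma> j = m))"
proof -
  have "(\<Sum>(j, m)\<in>matching_pairs. of_bool (\<sigma> j = m) :: nat)
      = card (matching_pairs \<inter> {jm. \<sigma> (fst jm) = snd jm})"
    using finite_matching_pairs by (simp add: case_prod_beta' of_bool_def sum.If_cases)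
  also have "\<dots> = matches \<sigma>"
    unfolding matches_def
    by (rule bij_betw_same_card[of fst], rule bij_betw_byWitness[where f' = "\<lambda>j. (j, \<sigma> j)"])
      (use assms in \<open>auto simp: matching_pairs_def permutes_in_image\<close>)
  finally show ?thesis by simp
qed

text \<open>Given that \<^term>\<open>j\<close> is sent to \<^term>\<open>m\<close>, a uniform permutation is distributed as
  \<open>transpose (\<sigma> j) m \<circ> \<sigma>\<close> for uniform \<^term>\<open>\<sigma>\<close>; this is the size-bias coupling.\<close>

lemma sum_matches_mult:
  fixes h :: "('a \<Rightarrow> 'a) \<Rightarrow> real"
  shows "real (card S) * (\<Sum>\<sigma> | \<sigma> permutes S. real (matches \<sigma>) * h \<sigma>) =
    (\<Sum>(j, m)\<in>matching_pairs. \<Sum>\<sigma> | \<sigma> permutes S. h (Transposition.transpose (\<sigma> j) m \<circ> \<sigma>))"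
proof -
  have "(\<Sum>\<sigma> | \<sigma> permutes S. real (matches \<sigma>) * h \<sigma>) =
      (\<Sum>\<sigma> | \<sigma> permutes S. \<Sum>(j, m)\<in>matching_pairs. of_bool (\<sigma> j = m) * h \<sigma>)"
    by (intro sum.cong refl) (simp add: matches_sum sum_distrib_right case_prod_beta')
  also have "\<dots> = (\<Sum>(j, m)\<in>matching_pairs. \<Sum>\<sigma> | \<sigma> permutes S. of_bool (\<sigma> j = m) * h \<sigma>)"
    by (simp add: case_prod_beta' sum.swap[of _ _ matching_pairs])
  also have "\<dots> = (\<Sum>(j, m)\<in>matching_pairs. \<Sum>\<sigma> | \<sigma> permutes S \<and> \<sigma> j = m. h \<sigma>)"
  proof (intro sum.cong refl, clarify)
    fix j m
    show "(\<Sum>\<sigma> | \<sigma> permutes S. of_bool (\<sigma> j = m) * h \<sigma>) =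
        (\<Sum>\<sigma> | \<sigma> permutes S \<and> \<sigma> j = m. h \<sigma>)"
      using finite_permutations[OF fin]
      by (intro sum.mono_neutral_cong_right) auto
  qed
  also have "real (card S) * \<dots> = (\<Sum>(j, m)\<in>matching_pairs.
      real (card S) * (\<Sum>\<sigma> | \<sigma> permutes S \<and> \<sigma> j = m. h \<sigma>))"
    by (simp add: sum_distrib_left case_prod_beta')
  \<comment> \<open>The factor \<open>card S\<close> is used up here: it is the number of fibres
    merged by \<open>sum_permutes_at\<close>.\<close>
  also have "\<dots> = (\<Sum>(j, m)\<in>matching_pairs.
      \<Sum>\<sigma> | \<sigma> permutes S. h (Transposition.transpose (\<sigma> j) m \<circ> \<sigma>))"
    by (intro sum.cong refl) (auto simp: matching_pairs_def sum_permutes_at fin)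
  finally show ?thesis .
qed

text \<open>Off \<open>j\<close> and \<open>r\<close> the two permutations agree; the new one sends
  \<open>j\<close> to \<open>m\<close> and \<open>r\<close> to \<open>\<sigma> j\<close>. If
  \<open>r \<noteq> j\<close>, the signed difference is exactly \<open>[c (\<sigma> j) = c j] +
  [c r = c m] - [c r = c (\<sigma> j)]\<close>.\<close>

lemma matches_coupling:
  assumes \<sigma>: "\<sigma> permutes S" and jm: "(j, m) \<in> matching_pairs"
  defines "r \<equiv> inv \<sigma> m"
  shows "\<bar>real (matches \<sigma>) + 1 - real (matches (Transposition.transpose (\<sigma> j) m \<circ> \<sigma>))\<bar> \<le>
    of_bool (c (\<sigma> j) = c j) + of_bool (c r = c m) + of_bool (r \<noteq> j \<and> c r = c (\<sigma> j))"
proof -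
  have S: "j \<in> S" "m \<in> S" "c j = c m"
    using jm by (auto simp: matching_pairs_def)
  have rm: "\<sigma> r = m" unfolding r_def using \<sigma> by (simp add: permutes_inverses)
  then have rS: "r \<in> S" using S(2) \<sigma> by (metis permutes_in_image)
  have mat: "real (matches \<tau>) = (\<Sum>x\<in>S. of_bool (c (\<tau> x) = c x))" for \<tau>
    using fin by (simp add: matches_def of_bool_def sum.If_cases Int_def)
  show ?thesis
  proof (cases "r = j")
    \<comment> \<open>The transposition is the identity here, so the difference is 1, while the
      first two indicators are both 1.\<close>
    case True
    then show ?thesis using rm S by simp
  next
    case False
    let ?\<tau> = "Transposition.transpose (\<sigma> j) m \<circ> \<sigma>"
    have *: "real (matches \<tau>) = of_bool (c (\<tau> j) = c j) + of_bool (c (\<tau> r) = c r)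
        + (\<Sum>x\<in>S - {j, r}. of_bool (c (\<tau> x) = c x))" for \<tau>
      using False S rS fin
      by (simp add: mat sum.remove[of S j] sum.remove[of "S - {j}" r] Diff_insert2[symmetric]
        insert_commute del: sum_of_bool_eq)
    have "(\<Sum>x\<in>S - {j, r}. of_bool (c (?\<tau> x) = c x)) = (\<Sum>x\<in>S - {j, r}. of_bool (c (\<sigma> x) = c x) :: real)"
    proof (intro sum.cong refl)
      fix x assume "x \<in> S - {j, r}"
      then have "\<sigma> x \<noteq> \<sigma> j" "\<sigma> x \<noteq> m"
        using permutes_inj[OF \<sigma>] rm by (auto dest: injD)
      then show "of_bool (c (?\<tau> x) = c x) = (of_bool (c (\<sigma> x) = c x) :: real)"
        by (simp add: Transposition.transpose_def)
    qed
    then show ?thesis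
      using False S rm unfolding *[of \<sigma>] *[of ?\<tau>] by (auto simp: of_bool_def)
  qed
qed

text \<open>For uniform \<open>\<sigma>\<close> each of the first two indicators in
  \<open>matches_coupling\<close> has mean at most the class size over \<open>n\<close>. The third
  event is covered by the events \<open>\<sigma> j = m'\<close>, \<open>\<sigma> r = m\<close> over
  pairs \<open>(r, m')\<close> of equal colour, each of probability \<open>1 / (n (n - 1))\<close>.
  Everything is scaled by \<open>n!\<close>.\<close>

lemma sum_coupling_le:
  assumes jm: "(j, m) \<in> matching_pairs" and n: "card S = n" "n \<ge> 2"
  shows "(\<Sum>\<sigma> | \<sigma> permutes S. \<bar>real (matches \<sigma>) + 1 - real (matches (Transposition.transpose (\<sigma> j) m \<circ> \<sigma>))\<bar>)
    \<le> fact n * (2 * real (card (colour_class (c j))) / real n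
        + real (card matching_pairs) / (real n * (real n - 1)))"
proof -
  let ?P = "{\<sigma>. \<sigma> permutes S}"
  let ?l = "real (card (colour_class (c j)))"
  have S: "j \<in> S" "m \<in> S" "c j = c m"
    using jm by (auto simp: matching_pairs_def)
  have finP: "finite ?P" using fin by (rule finite_permutations)
  have card1: "real (card {\<sigma>. \<sigma> permutes S \<and> \<sigma> x = y}) = fact n / real n" if "x \<in> S" "y \<in> S" for x y
    using card_permutes_at[OF fin that] n by (simp add: field_simps)
  have count: "(\<Sum>\<sigma>\<in>?P. of_bool (Q \<sigma>)) = real (card {\<sigma>. \<sigma> permutes S \<and> Q \<sigma>})" for Q
    using finP by (simp add: of_bool_def sum.If_cases Int_def)
  \<comment> \<open>Union bound over witnesses \<open>x\<close>, in counting form.\<close>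
  have le: "(\<Sum>\<sigma>\<in>?P. of_bool (Q \<sigma>)) \<le> (\<Sum>x\<in>I. real (card {\<sigma>. \<sigma> permutes S \<and> R x \<sigma>}))"
    if "\<And>\<sigma>. \<sigma> permutes S \<Longrightarrow> Q \<sigma> \<Longrightarrow> \<exists>x\<in>I. R x \<sigma>" "finite I"
    for Q and I :: "'c set" and R
  proof -
    have "{\<sigma>. \<sigma> permutes S \<and> Q \<sigma>} \<subseteq> (\<Union>x\<in>I. {\<sigma>. \<sigma> permutes S \<and> R x \<sigma>})"
      using that by auto
    then have "card {\<sigma>. \<sigma> permutes S \<and> Q \<sigma>} \<le> card (\<Union>x\<in>I. {\<sigma>. \<sigma> permutes S \<and> R x \<sigma>})"
      using that(2) fin by (intro card_mono) (auto intro: finite_permutes_filter)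
    also have "\<dots> \<le> (\<Sum>x\<in>I. card {\<sigma>. \<sigma> permutes S \<and> R x \<sigma>})"
      by (rule card_UN_le[OF that(2)])
    finally show ?thesis unfolding count of_nat_sum[symmetric] of_nat_le_iff .
  qed
  have fc: "finite (colour_class x)" for x using fin by (simp add: colour_class_def)
  have A: "(\<Sum>\<sigma>\<in>?P. of_bool (c (\<sigma> j) = c j)) \<le> ?l * (fact n / real n)"
  proof -
    have "(\<Sum>\<sigma>\<in>?P. of_bool (c (\<sigma> j) = c j))
        \<le> (\<Sum>x\<in>colour_class (c j). real (card {\<sigma>. \<sigma> permutes S \<and> \<sigma> j = x}))"
      using S by (intro le fc) (auto simp: colour_class_def permutes_in_image)
    also have "\<dots> = ?l * (fact n / real n)"
      using S by (simp add: card1 colour_class_def)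
    finally show ?thesis .
  qed
  have inv: "\<sigma> (inv \<sigma> m) = m" "inv \<sigma> m \<in> S" if "\<sigma> permutes S" for \<sigma>
    using that S by (auto simp: permutes_inverses permutes_in_image[OF permutes_inv])
  \<comment> \<open>The preimage of \<open>m\<close> takes the role of the image of
    \<open>j\<close>; as \<open>c j = c m\<close>, the same colour class bounds it.\<close>
  have B: "(\<Sum>\<sigma>\<in>?P. of_bool (c (inv \<sigma> m) = c m)) \<le> ?l * (fact n / real n)"
  proof -
    have "(\<Sum>\<sigma>\<in>?P. of_bool (c (inv \<sigma> m) = c m))
        \<le> (\<Sum>x\<in>colour_class (c j). real (card {\<sigma>. \<sigma> permutes S \<and> \<sigma> x = m}))"
      using S inv by (intro le fc) (auto simp: colour_class_def)
    also have "\<dots> = ?l * (fact n / real n)"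
      using S by (simp add: card1 colour_class_def)
    finally show ?thesis .
  qed
  have C: "(\<Sum>\<sigma>\<in>?P. of_bool (inv \<sigma> m \<noteq> j \<and> c (inv \<sigma> m) = c (\<sigma> j)))
      \<le> real (card matching_pairs) * (fact n / (real n * (real n - 1)))"
  proof -
    \<comment> \<open>The two exclusions supply the distinctness that
      \<open>card_permutes_at2\<close> requires; the final bound enlarges the index set to all pairs
      again.\<close>
    let ?I = "{(r, m') \<in> matching_pairs. r \<noteq> j \<and> m' \<noteq> m}"
    have sub: "?I \<subseteq> matching_pairs" by auto
    have fI: "finite ?I" by (rule finite_subset[OF sub finite_matching_pairs])
    have "(\<Sum>\<sigma>\<in>?P. of_bool (inv \<sigma> m \<noteq> j \<and> c (inv \<sigma> m) = c (\<sigma> j)))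
        \<le> (\<Sum>x\<in>?I. real (card {\<sigma>. \<sigma> permutes S \<and> (\<sigma> j = snd x \<and> \<sigma> (fst x) = m)}))"
    proof (rule le[OF _ fI])
      fix \<sigma> assume *: "\<sigma> permutes S" "inv \<sigma> m \<noteq> j \<and> c (inv \<sigma> m) = c (\<sigma> j)"
      have "\<sigma> j \<noteq> m" using * by (metis permutes_inverses(2))
      then show "\<exists>x\<in>?I. \<sigma> j = snd x \<and> \<sigma> (fst x) = m"
        using * S inv[OF *(1)]
        by (intro bexI[of _ "(inv \<sigma> m, \<sigma> j)"]) (auto simp: matching_pairs_def permutes_in_image)
    qed
    also have "\<dots> = (\<Sum>x\<in>?I. fact n / (real n * (real n - 1)))"
    proof (intro sum.cong refl, clarify)
      fix r m' assume "(r, m') \<in> matching_pairs" "r \<noteq> j" "m' \<noteq> m"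
      then show "real (card {\<sigma>. \<sigma> permutes S \<and> \<sigma> j = snd (r, m') \<and> \<sigma> (fst (r, m')) = m}) =
          fact n / (real n * (real n - 1))"
        using card_permutes_at2[OF fin S(1) _ S(2), of r m'] n
        by (auto simp: matching_pairs_def field_simps)
    qed
    also have "\<dots> \<le> real (card matching_pairs) * (fact n / (real n * (real n - 1)))"
      using card_mono[OF finite_matching_pairs sub] n by (simp add: mult_right_mono del: times_divide_eq_right)
    finally show ?thesis .
  qed
  have "(\<Sum>\<sigma>\<in>?P. \<bar>real (matches \<sigma>) + 1 - real (matches (Transposition.transpose (\<sigma> j) m \<circ> \<sigma>))\<bar>)
      \<le> (\<Sum>\<sigma>\<in>?P. of_bool (c (\<sigma> j) = c j) + of_bool (c (inv \<sigma> m) = c m)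
            + of_bool (inv \<sigma> m \<noteq> j \<and> c (inv \<sigma> m) = c (\<sigma> j)))"
    using matches_coupling[OF _ jm] by (intro sum_mono) auto
  also have "\<dots> \<le> ?l * (fact n / real n) + ?l * (fact n / real n)
      + real (card matching_pairs) * (fact n / (real n * (real n - 1)))"
    unfolding sum.distrib by (intro add_mono A B C)
  also have "\<dots> = fact n * (2 * ?l / real n + real (card matching_pairs) / (real n * (real n - 1)))"
    by (simp add: algebra_simps)
  finally show ?thesis .
qed

section \<open>Mean and Poisson approximation of the number of matches\<close>

lemma sum_matches:
  "real (card S) * (\<Sum>\<sigma> | \<sigma> permutes S. real (matches \<sigma>)) = fact (card S) * real (card matching_pairs)"
  using sum_matches_mult[of "\<lambda>_. 1"] fin by (simp add: card_permutations mult.commute)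

text \<open>Sum the Stein equation over all permutations. The coupling turns
  \<open>W * g (W - 1)\<close> into an average of \<open>g (W' - 1)\<close>, and the Lipschitz bound
  reduces the error to \<open>sum_coupling_le\<close>.\<close>

lemma matches_poisson_approx:
  assumes n: "card S = n" "n \<ge> 2" and lam: "lam = real (card matching_pairs) / real n" "lam > 0"
  shows "\<bar>(\<Sum>\<sigma> | \<sigma> permutes S. indicator B (matches \<sigma>)) / fact n
      - measure_pmf.prob (poisson_pmf lam) B\<bar>
    \<le> lam / (real n - 1) + 2 * (\<Sum>j\<in>S. real (card (colour_class (c j))) ^ 2) / (real n ^ 2 * lam)"
proof -
  let ?P = "{\<sigma>. \<sigma> permutes S}"
  define g where "g = stein_sol lam B"
  define N where "N = real (card matching_pairs)"
  define Q where "Q = (\<Sum>j\<in>S. real (card (colour_class (c j))) ^ 2)"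
  define D where "D = (\<Sum>\<sigma>\<in>?P. indicator B (matches \<sigma>)) - fact n * measure_pmf.prob (poisson_pmf lam) B"
  let ?T = "\<lambda>j m \<sigma>. Transposition.transpose (\<sigma> j) m \<circ> \<sigma>"
  have N: "N = real n * lam" using n lam by (simp add: N_def)
  have "D = (\<Sum>\<sigma>\<in>?P. indicator B (matches \<sigma>) - measure_pmf.prob (poisson_pmf lam) B)"
    using fin n by (simp add: D_def sum_subtractf card_permutations)
  also have "\<dots> = (\<Sum>\<sigma>\<in>?P. lam * g (matches \<sigma>) - real (matches \<sigma>) * g (matches \<sigma> - 1))"
    unfolding g_def by (simp only: stein_equation[OF lam(2)])
  also have "\<dots> = lam * (\<Sum>\<sigma>\<in>?P. g (matches \<sigma>)) - (\<Sum>\<sigma>\<in>?P. real (matches \<sigma>) * g (matches \<sigma> - 1))"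
    by (simp add: sum_subtractf sum_distrib_left)
  finally have "real n * D = N * (\<Sum>\<sigma>\<in>?P. g (matches \<sigma>))
      - real (card S) * (\<Sum>\<sigma>\<in>?P. real (matches \<sigma>) * g (matches \<sigma> - 1))"
    by (simp only: N n(1) right_diff_distrib mult.assoc)
  \<comment> \<open>As \<open>N\<close> is the number of pairs, the first term is a sum over pairs
    too, so each \<open>g (W)\<close> meets a \<open>g (W' - 1)\<close>.\<close>
  also have "\<dots> = (\<Sum>(j, m)\<in>matching_pairs. \<Sum>\<sigma>\<in>?P. g (matches \<sigma>) - g (matches (?T j m \<sigma>) - 1))"
    unfolding sum_matches_mult[of "\<lambda>\<sigma>. g (matches \<sigma> - 1)"]
    by (simp add: N_def case_prod_beta' sum_subtractf)
  finally have nD: "real n * D = \<dots>" .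
  have "real n * \<bar>D\<bar> = \<bar>real n * D\<bar>" by (simp add: abs_mult)
  also have "\<dots> \<le> (\<Sum>(j, m)\<in>matching_pairs.
      fact n * (2 * real (card (colour_class (c j))) / real n + N / (real n * (real n - 1))) / lam)"
    unfolding nD
  proof (rule order_trans[OF sum_abs sum_mono], clarify)
    fix j m assume jm: "(j, m) \<in> matching_pairs"
    have "\<bar>\<Sum>\<sigma>\<in>?P. g (matches \<sigma>) - g (matches (?T j m \<sigma>) - 1)\<bar>
        \<le> (\<Sum>\<sigma>\<in>?P. \<bar>real (matches \<sigma>) + 1 - real (matches (?T j m \<sigma>))\<bar> / lam)"
    proof (rule order_trans[OF sum_abs sum_mono])
      fix \<sigma>
      \<comment> \<open>The coupled permutation always has a match at \<open>j\<close>, so the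
        truncated \<open>- 1\<close> is a true subtraction and the arguments of \<open>g\<close>
        differ by \<open>W + 1 - W'\<close>.\<close>
      have "j \<in> {x \<in> S. c (?T j m \<sigma> x) = c x}"
        using jm by (simp add: matching_pairs_def)
      then have "matches (?T j m \<sigma>) \<ge> 1"
        using fin by (auto simp: matches_def Suc_le_eq card_gt_0_iff)
      then show "\<bar>g (matches \<sigma>) - g (matches (?T j m \<sigma>) - 1)\<bar>
          \<le> \<bar>real (matches \<sigma>) + 1 - real (matches (?T j m \<sigma>))\<bar> / lam"
        using stein_sol_lipschitz[OF lam(2), of B "matches \<sigma>" "matches (?T j m \<sigma>) - 1"]
        by (simp add: g_def of_nat_diff algebra_simps)
    qed
    also have "\<dots> \<le> fact n * (2 * real (card (colour_class (c j))) / real n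
        + N / (real n * (real n - 1))) / lam"
      unfolding sum_divide_distrib[symmetric] N_def
      using sum_coupling_le[OF jm n] lam(2) by (intro divide_right_mono) auto
    finally show "\<bar>\<Sum>\<sigma>\<in>?P. g (matches \<sigma>) - g (matches (?T j m \<sigma>) - 1)\<bar>
        \<le> fact n * (2 * real (card (colour_class (c j))) / real n
          + N / (real n * (real n - 1))) / lam" .
  qed
  also have "\<dots> = fact n * (2 * (\<Sum>(j, m)\<in>matching_pairs. real (card (colour_class (c j)))) / real n
      + N * (N / (real n * (real n - 1)))) / lam"
    by (simp add: case_prod_beta' sum_divide_distrib[symmetric] sum_distrib_left[symmetric] sum.distrib N_def)
  also have "(\<Sum>(j, m)\<in>matching_pairs. real (card (colour_class (c j)))) = Q"
    using sum_matching_pairs[of "\<lambda>x. real (card (colour_class x))"] by (simp add: Q_def power2_eq_square)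
  also have "fact n * (2 * Q / real n + N * (N / (real n * (real n - 1)))) / lam
      = real n * (fact n * (lam / (real n - 1) + 2 * Q / (real n ^ 2 * lam)))"
    using n(2) lam(2) by (simp add: N power2_eq_square divide_simps)
  finally have "\<bar>D\<bar> \<le> fact n * (lam / (real n - 1) + 2 * Q / (real n ^ 2 * lam))"
    using n(2) by simp
  then have "\<bar>D\<bar> / fact n \<le> lam / (real n - 1) + 2 * Q / (real n ^ 2 * lam)"
    by (simp add: pos_divide_le_eq mult.commute)
  moreover have "\<bar>D / fact n\<bar> = \<bar>(\<Sum>\<sigma>\<in>?P. indicator B (matches \<sigma>)) / fact n
      - measure_pmf.prob (poisson_pmf lam) B\<bar>"
    by (simp add: D_def diff_divide_distrib)
  ultimately show ?thesis by (simp add: Q_def)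
qed

end

section \<open>Specialisation to lists with prescribed multiplicities\<close>

lemma num_matches_eq: "num_matches a = matches {..<length a} ((!) a)"
  by (simp add: fun_eq_iff num_matches_def matches_def)

context
  fixes a :: "nat list" and k :: nat and l :: "nat \<Rightarrow> nat"
  assumes mset_a: "mset a = block_multiset k l"
begin

lemma count_block_multiset: "count (block_multiset k l) i = (if i \<in> {1..k} then l i else 0)"
  by (simp add: block_multiset_def count_sum)

lemma card_colour_class_list:
  assumes "i \<in> {1..k}"
  shows "card (colour_class {..<length a} ((!) a) i) = l i"
proof -
  have "card (colour_class {..<length a} ((!) a) i) = count (mset a) i"
    by (auto simp: colour_class_def count_mset count_list_eq_length_filter length_filter_conv_card
        intro: arg_cong[where f = card])
  then show ?thesis using assms by (simp add: mset_a count_block_multiset)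
qed

lemma nth_block_list: "j < length a \<Longrightarrow> a ! j \<in> {1..k}"
  using count_block_multiset[of "a ! j"] nth_mem[of j a]
  by (metis count_eq_zero_iff mset_a set_mset_mset)

text \<open>Positions are grouped by symbol. The choices \<open>h = 1\<close>, \<open>l\<close> and
  \<open>l^2\<close> yield the length, the sum of squares and the sum of cubes.\<close>

lemma sum_block_list:
  fixes h :: "nat \<Rightarrow> real"
  shows "(\<Sum>j<length a. h (a ! j)) = (\<Sum>i=1..k. real (l i) * h i)"
proof -
  have "(\<Sum>j<length a. h (a ! j)) = (\<Sum>i=1..k. \<Sum>j\<in>{j \<in> {..<length a}. a ! j = i}. h (a ! j))"
    using nth_block_list by (intro sum.group[symmetric]) auto
  also have "\<dots> = (\<Sum>i=1..k. real (card (colour_class {..<length a} ((!) a) i)) * h i)"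
    by (intro sum.cong refl) (simp add: colour_class_def)
  also have "\<dots> = (\<Sum>i=1..k. real (l i) * h i)"
    by (intro sum.cong refl) (simp only: card_colour_class_list)
  finally show ?thesis .
qed

end

theorem theorem6:
  fixes k n :: nat and l :: "nat \<Rightarrow> nat" and a :: "nat list"
    and W :: "(nat \<Rightarrow> nat) \<Rightarrow> nat" and \<mu> lam :: real
  assumes "k \<ge> 1"
    and "\<And>i. i \<in> {1..k} \<Longrightarrow> l i \<ge> 1"
    and "mset a = block_multiset k l"
    and "n = (\<Sum>i=1..k. l i)"
    and "n \<ge> 2"
    and "W = num_matches a"
    and "\<mu> = (\<Sum>i=1..k. real (l i) ^ 3)"
    and "lam = measure_pmf.expectation (random_permutation n) (\<lambda>\<sigma>. real (W \<sigma>))"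
  shows "lam = 1 / real n * (\<Sum>i=1..k. real (l i) ^ 2) \<and>
    tv_dist (measure_pmf (map_pmf W (random_permutation n))) (measure_pmf (poisson_pmf lam))
      \<le> 1.4 * (lam powr (3/2) / (real n - 1) + 3 * \<mu> / (2 * real n ^ 2 * lam powr (1/2)))"
proof -
  define S where "S = {..<length a}"
  define N where "N = real (card (matching_pairs S ((!) a)))"
  let ?P = "{\<sigma>. \<sigma> permutes {..<n}}"
  have fin: "finite S" by (simp add: S_def)
  note sums = sum_block_list[OF assms(3)]
  have cc: "card (colour_class S ((!) a) (a ! j)) = l (a ! j)" if "j \<in> S" for j
    using card_colour_class_list[OF assms(3) nth_block_list[OF assms(3)]] that by (simp add: S_def)
  have "real (length a) = real n" using sums[of "\<lambda>_. 1"] by (simp add: assms(4))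
  then have S: "S = {..<n}" "card S = n" by (simp_all add: S_def)
  have W: "W = matches S ((!) a)" by (simp add: assms(6) num_matches_eq S_def)
  have fP: "finite ?P" "card ?P = fact n" "?P \<noteq> {}"
    using permutes_id[of "{..<n}"]
    by (simp_all add: finite_permutations card_permutations ex_in_conv[symmetric] exI[of _ id])
  have "N = (\<Sum>j\<in>S. real (card (colour_class S ((!) a) (a ! j))))"
    using sum_matching_pairs[OF fin, where h = "\<lambda>_. 1" and c = "(!) a"] by (simp add: N_def)
  also have "\<dots> = (\<Sum>j\<in>S. real (l (a ! j)))" by (simp add: cc)
  finally have N: "N = (\<Sum>i=1..k. real (l i) ^ 2)"
    using sums[of "\<lambda>i. real (l i)"] by (simp add: S_def power2_eq_square)
  have "(\<Sum>j\<in>S. real (card (colour_class S ((!) a) (a ! j))) ^ 2) = (\<Sum>j\<in>S. real (l (a ! j)) ^ 2)"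
    by (simp add: cc)
  also have "\<dots> = \<mu>"
    using sums[of "\<lambda>i. real (l i) ^ 2"] by (simp add: S_def assms(7) power_numeral_reduce)
  finally have Q: "(\<Sum>j\<in>S. real (card (colour_class S ((!) a) (a ! j))) ^ 2) = \<mu>" .
  have "lam = (\<Sum>\<sigma>\<in>?P. real (W \<sigma>)) / fact n"
    unfolding assms(8) random_permutation_def using fP by (simp add: integral_pmf_of_set)
  moreover have "(\<Sum>\<sigma>\<in>?P. real (W \<sigma>)) = fact n * N / real n"
    using sum_matches[OF fin, of "(!) a"] assms(5) unfolding S(2)
    by (simp add: W N_def S(1)[symmetric] field_simps)
  ultimately have lam: "lam = N / real n" by simp
  have "real n = (\<Sum>i=1..k. real (l i))" by (simp add: assms(4))
  \<comment> \<open>Here \<open>l i \<ge> 1\<close> enters: it gives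
    \<open>l i \<le> (l i)^2\<close>, hence \<open>lam \<ge> 1\<close>.\<close>
  also have "\<dots> \<le> N"
    unfolding N
  proof (rule sum_mono)
    fix i assume "i \<in> {1..k}"
    then have "real (l i) \<ge> 1" using assms(2)[of i] by linarith
    then show "real (l i) \<le> real (l i) ^ 2" by (simp add: self_le_power)
  qed
  finally have lam1: "lam \<ge> 1" unfolding lam using assms(5) by (simp add: le_divide_eq)
  have \<mu>: "\<mu> \<ge> 0" unfolding assms(7) by (intro sum_nonneg) auto
  define s where "s = lam powr (1/2)"
  have s: "s \<ge> 1" "s ^ 2 = lam"
    using lam1 by (auto simp: s_def ge_one_powr_ge_zero powr_power)
  have s3: "lam powr (3/2) = lam * s"
    using lam1 powr_add[of lam 1 "1/2"] by (simp add: s_def)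
  have bound: "lam / (real n - 1) + 2 * \<mu> / (real n ^ 2 * lam)
      \<le> 1.4 * (lam powr (3/2) / (real n - 1) + 3 * \<mu> / (2 * real n ^ 2 * lam powr (1/2)))"
  proof -
    \<comment> \<open>With \<open>s\<close> the square root of \<open>lam\<close>,
      \<open>lam \<ge> 1\<close> gives \<open>s \<ge> 1\<close>, so the first term already fits
      without using the factor 1.4.\<close>
    have "1 * lam \<le> (1.4 * s) * lam" using s lam1 by (intro mult_right_mono) auto
    then have 1: "lam / (real n - 1) \<le> 1.4 * (lam * s) / (real n - 1)"
      using assms(5) by (intro divide_right_mono) (auto simp: mult_ac)
    have "s \<le> lam" using s by (metis self_le_power zero_less_numeral)
    \<comment> \<open>The constant 2.1 is \<open>1.4 * 3 / 2\<close>, the coefficient in the claimed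
      bound.\<close>
    then have "2 / lam \<le> 2.1 / s" using s by (intro frac_le) auto
    then have "(\<mu> / real n ^ 2) * (2 / lam) \<le> (\<mu> / real n ^ 2) * (2.1 / s)"
      using \<mu> by (intro mult_left_mono) auto
    then have 2: "2 * \<mu> / (real n ^ 2 * lam) \<le> 1.4 * (3 * \<mu> / (2 * real n ^ 2 * s))"
      by (simp add: mult_ac)
    show ?thesis
      using add_mono[OF 1 2] by (simp add: s3 s_def[symmetric] distrib_left)
  qed
  have "tv_dist (measure_pmf (map_pmf W (random_permutation n))) (measure_pmf (poisson_pmf lam))
      \<le> lam / (real n - 1) + 2 * \<mu> / (real n ^ 2 * lam)"
    unfolding tv_dist_def
  \<comment> \<open>The estimate is uniform in \<open>B\<close>, so it passes to the
    supremum.\<close>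
  proof (rule cSUP_least)
    fix B
    have "measure_pmf.prob (map_pmf W (random_permutation n)) B
        = measure_pmf.expectation (random_permutation n) (\<lambda>\<sigma>. indicator B (W \<sigma>))"
      by (simp add: indicator_vimage[symmetric])
    also have "\<dots> = (\<Sum>\<sigma>\<in>?P. indicator B (W \<sigma>)) / fact n"
      unfolding random_permutation_def using fP by (simp add: integral_pmf_of_set)
    finally show "\<bar>measure_pmf.prob (map_pmf W (random_permutation n)) B
        - measure_pmf.prob (poisson_pmf lam) B\<bar> \<le> lam / (real n - 1) + 2 * \<mu> / (real n ^ 2 * lam)"
      using matches_poisson_approx[OF fin S(2) assms(5) lam[unfolded N_def], of B] lam1
      by (simp add: W Q S(1)[symmetric])
  qed simp
  with bound show ?thesis by (simp add: lam N)
qed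

end
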